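(* Let $m\ge 2$ be an integer. For every $x\in(0,1)$ the set $\Lambda(x)=\{\lambda\in(0,1/m]: x\in K_\lambda\}$ is a topological Cantor set with $\min\Lambda(x)=\frac{x}{m-1+x}$ and $\max\Lambda(x)=\frac1m$.
   Context: For $\lambda\in(0,1/m]$, $K_\lambda=\left\{\sum_{i=1}^\infty d_i\lambda^i: d_i\in\{0,1,\ldots,m-1\},\ i\ge 1\right\}\subset\mathbb R$. A topological Cantor set is a nonempty compact subset of $\mathbb R$ having neither interior points nor isolated points. *)

theory Defs
  imports "HOL-Analysis.Analysis"
begin

definition cantor_set :: "real set \<Rightarrow> bool" where
  "cantor_set S \<longleftrightarrow>
     S \<noteq> {} \<and> compact S \<and> interior S = {} \<and> (\<forall>x\<in>S. \<not> x isolated_in S)"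

(* The digits are d 1, d 2, ...; d 0 is not used.  The series is only meaningful
   where it converges, which is always the case for 0 < l \<le> 1/m and m \<ge> 2. *)
definition K :: "nat \<Rightarrow> real \<Rightarrow> real set" where
  "K m l = {(\<Sum>i. real (d (Suc i)) * l ^ Suc i) | d :: nat \<Rightarrow> nat. \<forall>i\<ge>1. d i \<in> {0..<m}}"

definition Lam :: "nat \<Rightarrow> real \<Rightarrow> real set" where
  "Lam m x = {l \<in> {0<..1 / real m}. x \<in> K m l}"

end

theory Submission
  imports Defs
begin

text \<open>
  Give the space of digit sequences the product topology, in which it is compact, and regard the
  value of a series \<open>d\<^sub>1 \<lambda> + d\<^sub>2 \<lambda>\<^sup>2 + \<dots>\<close> as a function of the digits and of \<open>\<lambda>\<close> jointly.

  \<^item> Compactness: the value is jointly continuous by the Weierstrass test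
    (\<open>continuous_on_expansion\<close>), and \<open>\<lambda>\<close> stays away from 0 because the largest value attainable at
    \<open>\<lambda>\<close> is \<open>(m - 1) \<lambda> / (1 - \<lambda>)\<close>.  Hence \<open>\<Lambda>(x)\<close> is the projection of a compact set of pairs.
    The same bound gives the minimum, and expansions in base \<open>m\<close> give the maximum.

  \<^item> No isolated points: let \<open>d\<close> represent \<open>x\<close> at \<open>\<lambda>\<close>.  Adding 1 to a far digit increases the value
    only slightly, and since the value is continuous and increasing in \<open>\<lambda>\<close>, the number \<open>x\<close> is attained
    again by the new digits at some parameter slightly below \<open>\<lambda>\<close> (\<open>Lam_accumulates_left\<close>).
    Subtracting 1 produces a parameter slightly above \<open>\<lambda>\<close>, as long as \<open>\<lambda> < 1/m\<close>
    (\<open>Lam_accumulates_right\<close>).  One of the two changes is possible at arbitrarily far digits; at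
    \<open>\<lambda> = 1/m\<close> the first one is, if \<open>d\<close> is the greedy expansion, which does not end in digits \<open>m - 1\<close>.

  \<^item> Empty interior: for \<open>\<lambda> < 1/m\<close> the values of two digit sequences that first differ at the
    \<open>j\<close>-th digit are at least \<open>\<lambda>\<^sup>j (1 - m \<lambda>) / (1 - \<lambda>) > 0\<close> apart (\<open>expansion_gap\<close>).  So a number
    with a finite nonzero expansion is the right end of a gap of \<open>K\<^sub>\<lambda>\<close> whose length is bounded below.
    If \<open>x\<close> has a finite expansion at \<open>\<lambda>\<close>, then for parameters slightly larger than \<open>\<lambda>\<close> that endpoint
    has moved a little to the right and \<open>x\<close> lies in the gap.  Truncating expansions shows that such
    \<open>\<lambda>\<close> exist in every interval contained in \<open>\<Lambda>(x)\<close>.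
\<close>

section \<open>Digit sequences and their expansions\<close>

text \<open>
  Digits are real numbers and are indexed from 0, so that the digit \<open>d i\<close> has weight \<open>l ^ Suc i\<close>.
\<close>

definition digit_seqs :: "nat \<Rightarrow> (nat \<Rightarrow> real) set" where
  "digit_seqs m = (\<Pi>\<^sub>E i\<in>UNIV. real ` {..<m})"

definition expansion :: "(nat \<Rightarrow> real) \<Rightarrow> real \<Rightarrow> real" where
  "expansion d l = (\<Sum>i. d i * l ^ Suc i)"

lemma digit_seqs_iff: "d \<in> digit_seqs m \<longleftrightarrow> (\<forall>i. d i \<in> real ` {..<m})"
  by (auto simp: digit_seqs_def PiE_iff)

lemma digit_bounds:
  assumes "d \<in> digit_seqs m"
  shows "0 \<le> d i" "d i \<le> real m - 1"
proof -
  obtain k where "k < m" "d i = real k"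
    using assms by (auto simp: digit_seqs_iff)
  then show "0 \<le> d i" "d i \<le> real m - 1"
    by (auto simp: Suc_le_eq[symmetric] simp flip: of_nat_Suc)
qed

lemma digit_less_imp_add1_le:
  assumes "c \<in> digit_seqs m" "e \<in> digit_seqs m" "c i < e j"
  shows "c i + 1 \<le> e j"
proof -
  obtain k k' where "c i = real k" "e j = real k'"
    using assms by (meson digit_seqs_iff imageE)
  then show ?thesis using assms by simp
qed

lemma digit_Suc_in:
  assumes "d \<in> digit_seqs m" "d i < real m - 1"
  shows "d(i := d i + 1) \<in> digit_seqs m"
proof -
  obtain k where "k < m" "d i = real k"
    using assms by (auto simp: digit_seqs_iff)
  then have "d i + 1 = real (Suc k)" "Suc k < m"
    using assms(2) by auto
  then have "d i + 1 \<in> real ` {..<m}" by (metis image_eqI lessThan_iff)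
  then show ?thesis using assms(1) by (simp add: digit_seqs_iff)
qed

lemma digit_pred_in:
  assumes "d \<in> digit_seqs m" "d i > 0"
  shows "d(i := d i - 1) \<in> digit_seqs m"
proof -
  obtain k where "k < m" "d i = real k"
    using assms by (auto simp: digit_seqs_iff)
  then have "d i - 1 = real (k - 1)" "k - 1 < m"
    using assms(2) by auto
  then have "d i - 1 \<in> real ` {..<m}" by (metis image_eqI lessThan_iff)
  then show ?thesis using assms(1) by (simp add: digit_seqs_iff)
qed

lemma truncate_in_digit_seqs:
  assumes "d \<in> digit_seqs m"
  shows "(\<lambda>i. if i < n then d i else 0) \<in> digit_seqs m"
proof -
  have "m > 0" using assms by (auto simp: digit_seqs_iff intro: gr0I)
  then have "0 \<in> real ` {..<m}" by (metis image_eqI lessThan_iff of_nat_0)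
  then show ?thesis using assms by (simp add: digit_seqs_iff)
qed

lemma expansion_summable:
  assumes "d \<in> digit_seqs m" "0 \<le> l" "l < 1"
  shows "summable (\<lambda>i. d i * l ^ Suc i)"
proof (rule summable_comparison_test')
  show "summable (\<lambda>i. (real m - 1) * l ^ Suc i)"
    using assms by (intro summable_mult) (simp add: summable_geometric)
  show "norm (d i * l ^ Suc i) \<le> (real m - 1) * l ^ Suc i" if "0 \<le> i" for i
    using digit_bounds[OF assms(1), of i] assms(2)
    by (simp add: abs_mult mult_right_mono)
qed

lemma expansion_sums:
  assumes "d \<in> digit_seqs m" "0 \<le> l" "l < 1"
  shows "(\<lambda>i. d i * l ^ Suc i) sums expansion d l"
  using expansion_summable[OF assms] unfolding expansion_def by (rule summable_sums)

lemma sums_geometric_Suc: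
  fixes l :: real
  assumes "0 \<le> l" "l < 1"
  shows "(\<lambda>i. c * l ^ Suc i) sums (c * l / (1 - l))"
proof -
  have "(\<lambda>i. c * l * l ^ i) sums (c * l * (1 / (1 - l)))"
    using assms by (intro sums_mult geometric_sums) auto
  then show ?thesis by (simp add: mult.assoc)
qed

lemma expansion_le:
  assumes "d \<in> digit_seqs m" "0 \<le> l" "l < 1"
  shows "expansion d l \<le> (real m - 1) * l / (1 - l)"
  by (rule sums_le[OF _ expansion_sums[OF assms] sums_geometric_Suc[OF assms(2,3)]])
     (use digit_bounds[OF assms(1)] assms(2) in \<open>intro mult_right_mono, auto\<close>)

lemma expansion_update:
  assumes "d \<in> digit_seqs m" "0 \<le> l" "l < 1"
  shows "expansion (d(i := d i + c)) l = expansion d l + c * l ^ Suc i"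
proof -
  have "(\<lambda>j. d j * l ^ Suc j + (if j = i then c * l ^ Suc j else 0)) sums
          (expansion d l + c * l ^ Suc i)"
    by (intro sums_add expansion_sums[OF assms] sums_single)
  also have "(\<lambda>j. d j * l ^ Suc j + (if j = i then c * l ^ Suc j else 0)) =
               (\<lambda>j. (d(i := d i + c)) j * l ^ Suc j)"
    by (auto simp: algebra_simps)
  finally show ?thesis unfolding expansion_def by (simp add: sums_iff)
qed

lemma expansion_truncate:
  "expansion (\<lambda>i. if i < n then d i else 0) l = (\<Sum>i<n. d i * l ^ Suc i)"
  unfolding expansion_def by (subst suminf_finite[of "{..<n}"]) auto

text \<open>
  The space of digit sequences carries the product topology of the function space, so that
  continuity is joint in the digits and the parameter.
\<close>

lemma continuous_on_expansion:
  assumes "r < 1"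
  shows "continuous_on (digit_seqs m \<times> {0..r}) (\<lambda>p. expansion (fst p) (snd p))"
proof (cases "0 \<le> r")
  case True
  have "uniform_limit (digit_seqs m \<times> {0..r}) (\<lambda>n p. \<Sum>i<n. fst p i * snd p ^ Suc i)
          (\<lambda>p. \<Sum>i. fst p i * snd p ^ Suc i) sequentially"
  proof (rule Weierstrass_m_test)
    show "summable (\<lambda>i. (real m - 1) * r ^ Suc i)"
      using True assms by (intro summable_mult) (simp add: summable_geometric)
    fix i and p :: "(nat \<Rightarrow> real) \<times> real"
    assume p: "p \<in> digit_seqs m \<times> {0..r}"
    then have d: "0 \<le> fst p i" "fst p i \<le> real m - 1" and l: "0 \<le> snd p" "snd p \<le> r"
      using digit_bounds[of "fst p" m i] by auto
    have "norm (fst p i * snd p ^ Suc i) = fst p i * snd p ^ Suc i"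
      using d l by (simp add: abs_mult)
    also have "\<dots> \<le> (real m - 1) * r ^ Suc i"
      using d l by (intro mult_mono power_mono) auto
    finally show "norm (fst p i * snd p ^ Suc i) \<le> (real m - 1) * r ^ Suc i" .
  qed
  moreover have "continuous_on (digit_seqs m \<times> {0..r}) (\<lambda>p. \<Sum>i<n. fst p i * snd p ^ Suc i)" for n
    by (intro continuous_intros continuous_on_product_then_coordinatewise)
  ultimately show ?thesis
    unfolding expansion_def by (intro uniform_limit_theorem) auto
qed auto

lemma compact_digit_seqs: "compact (digit_seqs m)"
proof -
  have "compactin (product_topology (\<lambda>i. euclidean) UNIV) (digit_seqs m)"
    unfolding digit_seqs_def by (subst compactin_PiE) (auto intro: finite_imp_compact)
  then show ?thesis by (simp add: euclidean_product_topology)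
qed

lemma continuous_on_expansion_param:
  assumes "d \<in> digit_seqs m" "r < 1"
  shows "continuous_on {0..r} (expansion d)"
proof -
  have "continuous_on {0..r} (\<lambda>l. (\<lambda>p. expansion (fst p) (snd p)) (d, l))"
    by (rule continuous_on_compose2[OF continuous_on_expansion[OF assms(2), of m]])
       (use assms(1) in \<open>auto intro!: continuous_intros\<close>)
  then show ?thesis by simp
qed

text \<open>
  A nonzero value at any parameter \<open>k\<close> shows that some digit is positive.
\<close>

lemma expansion_strict_mono:
  assumes "d \<in> digit_seqs m" "0 \<le> l" "l < l'" "l' < 1" "expansion d k \<noteq> 0"
  shows "expansion d l < expansion d l'"
proof -
  have "\<exists>i. d i \<noteq> 0"
  proof (rule ccontr)
    assume "\<nexists>i. d i \<noteq> 0"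
    then have "expansion d k = 0" by (simp add: expansion_def)
    with assms(5) show False by simp
  qed
  then obtain i where i: "d i > 0"
    using digit_bounds(1)[OF assms(1)] by (metis order_le_less)
  have pow: "l ^ Suc j < l' ^ Suc j" for j
    using assms by (intro power_strict_mono) auto
  have le: "0 \<le> d j * (l' ^ Suc j - l ^ Suc j)" for j
    using digit_bounds(1)[OF assms(1), of j] pow[of j] by simp
  have "(\<lambda>j. d j * l' ^ Suc j - d j * l ^ Suc j) sums (expansion d l' - expansion d l)"
    using assms by (intro sums_diff expansion_sums[where m = m]) auto
  then have s: "(\<lambda>j. d j * (l' ^ Suc j - l ^ Suc j)) sums (expansion d l' - expansion d l)"
    by (simp only: right_diff_distrib)
  have "0 < (\<Sum>j. d j * (l' ^ Suc j - l ^ Suc j))"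
    using i pow[of i] by (intro suminf_pos2[where i = i] sums_summable[OF s] le) auto
  then show ?thesis using s by (simp add: sums_iff)
qed

text \<open>
  The difference of the two series is smallest when \<open>e j = c j + 1\<close> and all the later digits are 0
  in \<open>e\<close> and \<open>m - 1\<close> in \<open>c\<close>; a geometric sum gives the bound.
\<close>

lemma expansion_gap:
  assumes ce: "c \<in> digit_seqs m" "e \<in> digit_seqs m"
    and eq: "\<And>i. i < j \<Longrightarrow> c i = e i" and less: "c j < e j" and l: "0 \<le> l" "l < 1"
  shows "expansion e l - expansion c l \<ge> l ^ Suc j * (1 - real m * l) / (1 - l)"
proof -
  \<comment> \<open>The digit differences in the extremal case.\<close>
  define b where "b i = (if i < j then 0 else if i = j then 1 else - (real m - 1))" for i
  have diff: "(\<lambda>i. e i * l ^ Suc i - c i * l ^ Suc i) sums (expansion e l - expansion c l)"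
    using ce l by (intro sums_diff expansion_sums)
  have tail: "(\<lambda>i. b (i + Suc j) * l ^ Suc (i + Suc j)) sums
      (- (real m - 1) * l ^ Suc j * l / (1 - l))"
    using sums_geometric_Suc[OF l, of "- (real m - 1) * l ^ Suc j"]
    by (simp add: b_def power_add mult_ac)
  have head: "(\<Sum>i<Suc j. b i * l ^ Suc i) = l ^ Suc j"
    by (simp add: b_def)
  have "(\<lambda>i. b i * l ^ Suc i) sums (- (real m - 1) * l ^ Suc j * l / (1 - l) + l ^ Suc j)"
    using iffD1[OF sums_iff_shift[of "\<lambda>i. b i * l ^ Suc i" "Suc j"] tail] unfolding head .
  also have "- (real m - 1) * l ^ Suc j * l / (1 - l) + l ^ Suc j =
      l ^ Suc j * (1 - real m * l) / (1 - l)"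
    using l by (simp add: field_simps)
  finally have b: "(\<lambda>i. b i * l ^ Suc i) sums (l ^ Suc j * (1 - real m * l) / (1 - l))" .
  have "b i \<le> e i - c i" for i
  proof -
    consider "i < j" | "i = j" | "i > j" by linarith
    then show ?thesis
    proof cases
      case 2
      then show ?thesis using digit_less_imp_add1_le[OF ce less] by (simp add: b_def)
    next
      case 3
      then show ?thesis
        using digit_bounds[OF ce(1), of i] digit_bounds[OF ce(2), of i] by (simp add: b_def)
    qed (simp add: b_def eq)
  qed
  then have "b i * l ^ Suc i \<le> e i * l ^ Suc i - c i * l ^ Suc i" for i
    using l mult_right_mono[of "b i" "e i - c i" "l ^ Suc i"] by (simp add: left_diff_distrib)
  then show ?thesis by (rule sums_le[OF _ b diff])
qed

section \<open>Expansions in base m\<close>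

text \<open>
  The greedy algorithm keeps remainders \<open>r i\<close> in \<open>[0, 1)\<close>.  If every digit from \<open>N\<close> on were
  \<open>m - 1\<close>, then \<open>1 - r i\<close> would be multiplied by \<open>m\<close> in each step and would become unbounded.
\<close>

lemma greedy_expansion_exists:
  assumes m: "m \<ge> 2" and x: "0 \<le> x" "x < 1"
  obtains d where "d \<in> digit_seqs m" "expansion d (1 / real m) = x"
    "\<And>N. \<exists>i\<ge>N. d i < real m - 1"
proof -
  define r where "r i = ((\<lambda>t. frac (real m * t)) ^^ i) x" for i
  define d where "d i = real m * r i - r (Suc i)" for i
  have r: "0 \<le> r i" "r i < 1" for i
    using x by (cases i, auto simp: r_def frac_lt_1)+
  have d_floor: "d i = of_int \<lfloor>real m * r i\<rfloor>" for i
    by (simp add: d_def r_def frac_def)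
  have d: "d \<in> digit_seqs m"
    unfolding digit_seqs_iff
  proof
    fix i
    have lt: "real m * r i < real m" using r[of i] m by simp
    have "\<lfloor>real m * r i\<rfloor> < int m" using lt by linarith
    moreover have "0 \<le> \<lfloor>real m * r i\<rfloor>" using r[of i] by simp
    ultimately have "d i = real (nat \<lfloor>real m * r i\<rfloor>)" "nat \<lfloor>real m * r i\<rfloor> < m"
      unfolding d_floor by linarith+
    then show "d i \<in> real ` {..<m}" by (metis image_eqI lessThan_iff)
  qed
  have partial: "(\<Sum>i<n. d i * (1 / real m) ^ Suc i) = x - r n * (1 / real m) ^ n" for n
  proof (induction n)
    case 0
    show ?case by (simp add: r_def)
  next
    case (Suc n)
    show ?case
      unfolding sum.lessThan_Suc Suc using m by (simp add: d_def field_simps)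
  qed
  have p0: "(\<lambda>n. (1 / real m) ^ n) \<longlonglongrightarrow> 0"
    using m by (intro LIMSEQ_power_zero) auto
  have "(\<lambda>n. r n * (1 / real m) ^ n) \<longlonglongrightarrow> 0"
  proof (rule tendsto_sandwich[OF _ _ tendsto_const p0])
    show "\<forall>\<^sub>F n in sequentially. 0 \<le> r n * (1 / real m) ^ n"
      using r by (intro always_eventually allI) simp
    show "\<forall>\<^sub>F n in sequentially. r n * (1 / real m) ^ n \<le> (1 / real m) ^ n"
      using r by (intro always_eventually allI mult_left_le_one_le) (auto intro: less_imp_le)
  qed
  then have "(\<lambda>n. x - r n * (1 / real m) ^ n) \<longlonglongrightarrow> x - 0"
    by (intro tendsto_diff tendsto_const)
  then have "(\<lambda>i. d i * (1 / real m) ^ Suc i) sums x"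
    unfolding sums_def partial by simp
  then have ex: "expansion d (1 / real m) = x"
    unfolding expansion_def by (simp add: sums_iff)
  have "\<exists>i\<ge>N. d i < real m - 1" for N
  proof (rule ccontr)
    assume "\<not> (\<exists>i\<ge>N. d i < real m - 1)"
    then have dm: "d i = real m - 1" if "i \<ge> N" for i
      using that digit_bounds(2)[OF d, of i] by force
    have "1 - r (N + k) = real m ^ k * (1 - r N)" for k
    proof (induction k)
      case (Suc k)
      have "1 - r (N + Suc k) = real m * (1 - r (N + k))"
        using dm[of "N + k"] by (simp add: d_def algebra_simps)
      then show ?case by (simp add: Suc)
    qed simp
    moreover obtain k where "1 / (1 - r N) < real m ^ k"
      using real_arch_pow[of "real m"] m by auto
    ultimately have "1 < 1 - r (N + k)"
      using r[of N] by (simp add: field_simps)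
    then show False using r[of "N + k"] by simp
  qed
  then show ?thesis using that d ex by blast
qed

section \<open>The parameter set\<close>

lemma K_eq_expansions: "K m l = (\<lambda>d. expansion d l) ` digit_seqs m"
proof (intro equalityI subsetI)
  fix y assume "y \<in> K m l"
  then obtain d :: "nat \<Rightarrow> nat" where d: "y = (\<Sum>i. real (d (Suc i)) * l ^ Suc i)"
      "\<forall>i\<ge>1. d i \<in> {0..<m}"
    unfolding K_def by blast
  then have "(\<lambda>i. real (d (Suc i))) \<in> digit_seqs m" by (auto simp: digit_seqs_iff)
  then show "y \<in> (\<lambda>d. expansion d l) ` digit_seqs m"
    by (rule rev_image_eqI) (simp add: d(1) expansion_def)
next
  fix y assume "y \<in> (\<lambda>d. expansion d l) ` digit_seqs m"
  then obtain d where d: "d \<in> digit_seqs m" "y = expansion d l" by blast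
  then have "\<forall>i. \<exists>k. d i = real k \<and> k < m" by (auto simp: digit_seqs_iff)
  then obtain f where f: "\<And>i. d i = real (f i)" "\<And>i. f i < m" by metis
  have "y = (\<Sum>i. real ((\<lambda>i. f (i - 1)) (Suc i)) * l ^ Suc i)"
    using d(2) f(1) by (simp add: expansion_def)
  moreover have "\<forall>i\<ge>1. (\<lambda>i. f (i - 1)) i \<in> {0..<m}" using f(2) by simp
  ultimately show "y \<in> K m l"
    unfolding K_def mem_Collect_eq by (intro exI[of _ "\<lambda>i. f (i - 1)"] conjI)
qed

lemma Lam_iff:
  "l \<in> Lam m x \<longleftrightarrow> 0 < l \<and> l \<le> 1 / real m \<and> (\<exists>d\<in>digit_seqs m. expansion d l = x)"
  unfolding Lam_def K_eq_expansions by auto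

locale base_and_target =
  fixes m :: nat and x :: real
  assumes m: "m \<ge> 2" and x: "0 < x" "x < 1"
begin

lemma inverse_base_less_1: "1 / real m < 1"
  using m by simp

lemma Lam_max: "1 / real m \<in> Lam m x"
  using greedy_expansion_exists[OF m, of x] x m by (auto simp: Lam_iff)

lemma Lam_lower_bound:
  assumes "l \<in> Lam m x"
  shows "x / (real m - 1 + x) \<le> l"
proof -
  obtain d where d: "d \<in> digit_seqs m" "expansion d l = x" and l: "0 < l" "l \<le> 1 / real m"
    using assms by (auto simp: Lam_iff)
  have l1: "l < 1" using l inverse_base_less_1 by linarith
  have "x \<le> (real m - 1) * l / (1 - l)"
    using expansion_le[OF d(1)] d(2) l l1 by auto
  then show ?thesis using l1 m x by (simp add: field_simps)
qed

text \<open>The value \<open>(m - 1) \<lambda> / (1 - \<lambda>)\<close> of the largest digit sequence equals \<open>x\<close> exactly here.\<close>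

lemma Lam_min: "x / (real m - 1 + x) \<in> Lam m x"
proof -
  define l where "l = x / (real m - 1 + x)"
  have pos: "0 < real m - 1 + x" "0 < real m - 1" using m x by auto
  have "x * real m \<le> real m - 1 + x"
    using mult_right_mono[of x 1 "real m - 1"] x pos by (simp add: algebra_simps)
  then have l: "0 < l" "l \<le> 1 / real m"
    using pos x m by (auto simp: l_def field_simps)
  have l1: "l < 1" using l inverse_base_less_1 by linarith
  have "real m - 1 = real (m - 1)" using m by simp
  then have "real m - 1 \<in> real ` {..<m}"
    using m by (metis diff_less image_eqI lessThan_iff less_le_trans pos2 zero_less_one)
  then have "(\<lambda>i. real m - 1) \<in> digit_seqs m" by (simp add: digit_seqs_iff)
  moreover have "expansion (\<lambda>i. real m - 1) l = (real m - 1) * l / (1 - l)"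
    using sums_geometric_Suc[of l "real m - 1"] l l1 by (simp add: expansion_def sums_iff)
  moreover have "(real m - 1) * l / (1 - l) = x"
  proof -
    have "1 - l = (real m - 1) / (real m - 1 + x)"
      using pos by (simp add: l_def field_simps)
    then show ?thesis using pos by (simp add: l_def)
  qed
  ultimately show ?thesis using l unfolding l_def[symmetric] Lam_iff by auto
qed

text \<open>
  The lower bound \<open>a\<close> makes the parameter range compact: the set of pairs of digits and parameters
  that represent \<open>x\<close> is then closed in a compact product, and its projection is the parameter set.
\<close>

lemma compact_Lam: "compact (Lam m x)"
proof -
  define a where "a = x / (real m - 1 + x)"
  define P where "P = digit_seqs m \<times> {a..1 / real m}"
  define Q where "Q = P \<inter> (\<lambda>p. expansion (fst p) (snd p)) -` {x}"
  have a: "0 < a" using m x by (auto simp: a_def)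
  have "compact P" unfolding P_def by (intro compact_Times compact_digit_seqs compact_Icc)
  moreover have "continuous_on P (\<lambda>p. expansion (fst p) (snd p))"
    by (rule continuous_on_subset[OF continuous_on_expansion[OF inverse_base_less_1]])
       (use a in \<open>auto simp: P_def\<close>)
  then have "closedin (top_of_set P) Q"
    unfolding Q_def by (intro continuous_closedin_preimage) auto
  ultimately have "compact Q" by (rule closedin_compact)
  then have "compact (snd ` Q)"
    by (intro compact_continuous_image continuous_intros)
  moreover have "Lam m x = snd ` Q"
  proof (intro equalityI subsetI)
    fix l assume l: "l \<in> Lam m x"
    then obtain d where d: "d \<in> digit_seqs m" "expansion d l = x" "l \<le> 1 / real m"
      by (auto simp: Lam_iff)
    then have "(d, l) \<in> Q" using Lam_lower_bound[OF l] by (simp add: Q_def P_def a_def)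
    then show "l \<in> snd ` Q" by force
  next
    fix l assume "l \<in> snd ` Q"
    then show "l \<in> Lam m x" using a by (auto simp: Q_def P_def Lam_iff)
  qed
  ultimately show ?thesis by simp
qed

subsection \<open>Absence of isolated points\<close>

lemma expansion_hits_target:
  assumes e: "e \<in> digit_seqs m" and ab: "0 \<le> a" "a < b" "b \<le> 1 / real m"
    and lo: "expansion e a < x" and hi: "x < expansion e b"
  obtains l where "a < l" "l < b" "l \<in> Lam m x"
proof -
  have "continuous_on {a..b} (expansion e)"
    by (rule continuous_on_subset[OF continuous_on_expansion_param[OF e inverse_base_less_1]])
       (use ab in auto)
  then obtain l where l: "a \<le> l" "l \<le> b" "expansion e l = x"
    using IVT'[of "expansion e" a x b] ab lo hi by auto
  then have "a \<noteq> l" "l \<noteq> b" using lo hi by auto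
  then show ?thesis using that[of l] l ab e by (auto simp: Lam_iff)
qed

lemma far_weight_small:
  assumes "0 \<le> l" "l < 1" "0 < (\<delta> :: real)"
  obtains N where "\<And>i. i \<ge> N \<Longrightarrow> l ^ Suc i < \<delta>"
proof -
  have "(\<lambda>i. l ^ Suc i) \<longlonglongrightarrow> 0"
    using assms by (intro LIMSEQ_Suc LIMSEQ_power_zero) auto
  then have "\<forall>\<^sub>F i in sequentially. l ^ Suc i < \<delta>"
    by (rule order_tendstoD(2)[OF _ assms(3)])
  then show ?thesis using that unfolding eventually_sequentially by blast
qed

text \<open>
  At a fixed parameter \<open>a\<close> below \<open>l\<close> the value of \<open>d\<close> falls short of \<open>x\<close> by a fixed amount.  Raising a
  digit whose weight is less than that amount keeps the value at \<open>a\<close> below \<open>x\<close> but lifts the value at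
  \<open>l\<close> above \<open>x\<close>, so the new digits represent \<open>x\<close> at a parameter in between.
\<close>

lemma Lam_accumulates_left:
  assumes d: "d \<in> digit_seqs m" "expansion d l = x" and l: "0 < l" "l \<le> 1 / real m"
    and room: "\<And>N. \<exists>i\<ge>N. d i < real m - 1" and "a < l"
  obtains l' where "a < l'" "l' < l" "l' \<in> Lam m x"
proof -
  define b where "b = max a 0"
  have b: "0 \<le> b" "b < l" "a \<le> b" using l \<open>a < l\<close> by (auto simp: b_def)
  have l1: "l < 1" using l inverse_base_less_1 by linarith
  have "expansion d b < x"
    using expansion_strict_mono[OF d(1) b(1,2) l1, of l] d(2) x by simp
  then obtain N where N: "\<And>i. i \<ge> N \<Longrightarrow> b ^ Suc i < x - expansion d b"
    using far_weight_small[of b "x - expansion d b"] b l1 by auto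
  obtain i where i: "i \<ge> N" "d i < real m - 1" using room by blast
  define e where "e = d(i := d i + 1)"
  have "e \<in> digit_seqs m" unfolding e_def using d(1) i(2) by (rule digit_Suc_in)
  moreover have "expansion e b < x"
    using N[OF i(1)] expansion_update[OF d(1), of b i 1] b l1 by (simp add: e_def)
  moreover have "x < expansion e l"
    using expansion_update[OF d(1), of l i 1] l l1 d(2) by (simp add: e_def)
  ultimately obtain l' where "b < l'" "l' < l" "l' \<in> Lam m x"
    using expansion_hits_target[of e b l] b l by blast
  then show ?thesis using that[of l'] b by simp
qed

text \<open>
  The mirror image, with a lowered digit.  Here \<open>l < 1 / m\<close> leaves admissible parameters above \<open>l\<close>.
\<close>

lemma Lam_accumulates_right:
  assumes d: "d \<in> digit_seqs m" "expansion d l = x" and l: "0 < l" "l < 1 / real m"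
    and room: "\<And>N. \<exists>i\<ge>N. d i > 0" and "l < b"
  obtains l' where "l < l'" "l' < b" "l' \<in> Lam m x"
proof -
  define c where "c = min b (1 / real m)"
  have c: "l < c" "c \<le> b" "c \<le> 1 / real m" using l \<open>l < b\<close> by (auto simp: c_def)
  have c1: "0 \<le> c" "c < 1" "l < 1" using c l inverse_base_less_1 by linarith+
  have "x < expansion d c"
    using expansion_strict_mono[OF d(1) _ c(1) c1(2), of l] d(2) l x by simp
  then obtain N where N: "\<And>i. i \<ge> N \<Longrightarrow> c ^ Suc i < expansion d c - x"
    using far_weight_small[of c "expansion d c - x"] c1 by auto
  obtain i where i: "i \<ge> N" "d i > 0" using room by blast
  define e where "e = d(i := d i + (- 1))"
  have "e \<in> digit_seqs m" unfolding e_def using digit_pred_in[OF d(1) i(2)] by simp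
  moreover have "x < expansion e c"
    using N[OF i(1)] expansion_update[OF d(1), of c i "- 1"] c1 unfolding e_def by simp
  moreover have "expansion e l < x"
    using expansion_update[OF d(1), of l i "- 1"] l c1 d(2) unfolding e_def by simp
  ultimately obtain l' where "l < l'" "l' < c" "l' \<in> Lam m x"
    using expansion_hits_target[of e l c] c l by auto
  then show ?thesis using that[of l'] c by simp
qed

lemma Lam_not_isolated: "\<not> l isolated_in Lam m x"
proof
  assume iso: "l isolated_in Lam m x"
  then have "l \<in> Lam m x" by (simp add: isolated_in_islimpt_iff)
  then have l: "0 < l" "l \<le> 1 / real m" by (auto simp: Lam_iff)
  obtain \<epsilon> where \<epsilon>: "\<epsilon> > 0" "\<And>y. y \<in> Lam m x \<Longrightarrow> dist l y < \<epsilon> \<Longrightarrow> y = l"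
    using isolated_inE_dist[OF iso] by metis
  \<comment> \<open>At the maximum the digits have to be chosen; elsewhere any expansion will do.\<close>
  obtain d where d: "d \<in> digit_seqs m" "expansion d l = x"
    and max: "l = 1 / real m \<Longrightarrow> \<forall>N. \<exists>i\<ge>N. d i < real m - 1"
  proof (cases "l = 1 / real m")
    case True
    then show ?thesis using greedy_expansion_exists[OF m, of x] x that by (metis less_imp_le)
  next
    case False
    then show ?thesis using \<open>l \<in> Lam m x\<close> that by (auto simp: Lam_iff)
  qed
  show False
  proof (cases "\<forall>N. \<exists>i\<ge>N. d i < real m - 1")
    case True
    then obtain l' where "l - \<epsilon> < l'" "l' < l" "l' \<in> Lam m x"
      using Lam_accumulates_left[OF d l, of "l - \<epsilon>"] \<epsilon>(1) by auto
    then show False using \<epsilon>(2)[of l'] by (auto simp: dist_real_def)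
  next
    case False
    then obtain M where M: "\<And>i. i \<ge> M \<Longrightarrow> d i \<ge> real m - 1" by force
    have "\<exists>i\<ge>N. d i > 0" for N
      using M[of "max M N"] m by (intro exI[of _ "max M N"]) auto
    moreover have "l < 1 / real m" using False max l by force
    ultimately obtain l' where "l < l'" "l' < l + \<epsilon>" "l' \<in> Lam m x"
      using Lam_accumulates_right[OF d l(1), of "l + \<epsilon>"] \<epsilon>(1) by auto
    then show False using \<epsilon>(2)[of l'] by (auto simp: dist_real_def)
  qed
qed

subsection \<open>Empty interior\<close>

text \<open>
  Compare a finite expansion \<open>e\<close> with an arbitrary expansion \<open>c\<close> at their first difference: beyond
  the end of \<open>e\<close> the digits of \<open>c\<close> can only be larger, and before it \<open>expansion_gap\<close> applies.
\<close>

lemma finite_expansion_gap: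
  assumes ce: "c \<in> digit_seqs m" "e \<in> digit_seqs m" and e0: "\<And>i. i \<ge> n \<Longrightarrow> e i = 0"
    and l: "0 < l" "l < 1 / real m" and less: "expansion c l < expansion e l"
  shows "l ^ Suc n * (1 - real m * l) / (1 - l) \<le> expansion e l - expansion c l"
proof -
  have l1: "l < 1" using l inverse_base_less_1 by linarith
  have ml: "0 < 1 - real m * l" using l m by (simp add: field_simps)
  have "c \<noteq> e" using less by auto
  then have ex: "\<exists>i. c i \<noteq> e i" by auto
  define j where "j = (LEAST i. c i \<noteq> e i)"
  have j: "c j \<noteq> e j" using LeastI_ex[OF ex] by (simp add: j_def)
  have eq: "c i = e i" if "i < j" for i using not_less_Least that unfolding j_def by blast
  have "\<not> e j < c j"
  proof
    assume "e j < c j"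
    then have "l ^ Suc j * (1 - real m * l) / (1 - l) \<le> expansion c l - expansion e l"
      using expansion_gap[OF ce(2,1), of j l] eq l l1 by auto
    moreover have "0 \<le> l ^ Suc j * (1 - real m * l) / (1 - l)" using l l1 ml by simp
    ultimately show False using less by linarith
  qed
  then have cj: "c j < e j" using j by simp
  then have "j \<le> n"
    using e0[of j] digit_bounds(1)[OF ce(1), of j] by (metis linorder_not_le less_imp_le)
  then have "l ^ Suc n \<le> l ^ Suc j" using l l1 by (intro power_decreasing) auto
  then have "l ^ Suc n * (1 - real m * l) / (1 - l) \<le> l ^ Suc j * (1 - real m * l) / (1 - l)"
    using l1 ml by (intro divide_right_mono mult_right_mono) auto
  also have "\<dots> \<le> expansion e l - expansion c l"
    using expansion_gap[OF ce eq cj] l l1 by auto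
  finally show ?thesis .
qed

text \<open>
  Just to the right of \<open>l\<close> the value of \<open>e\<close> exceeds \<open>x\<close> by monotonicity, but by continuity it does so
  by less than the length of the gap of \<open>K\<^sub>t\<close> that lies below this value.
\<close>

lemma Lam_gap_right_of_finite_expansion:
  assumes e: "e \<in> digit_seqs m" and e0: "\<And>i. i \<ge> n \<Longrightarrow> e i = 0"
    and l: "0 < l" "l < b" "b < 1 / real m" and ex: "expansion e l = x"
  obtains l' where "l < l'" "l' < b" "l' \<notin> Lam m x"
proof -
  \<comment> \<open>If \<open>h t < 0\<close>, then \<open>x\<close> lies above the left end of the gap below the value of \<open>e\<close> at \<open>t\<close>.\<close>
  define h where "h t = expansion e t - x - t ^ Suc n * (1 - real m * t) / (1 - t)" for t
  have b1: "b < 1" "l < 1" using l inverse_base_less_1 by linarith+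
  have "l < 1 / real m" using l by simp
  then have ml: "0 < 1 - real m * l" using m by (simp add: field_simps)
  have "h l < 0" using ex l b1 ml by (simp add: h_def)
  moreover have "continuous_on {l..b} h"
    unfolding h_def using b1 l
    by (intro continuous_intros continuous_on_subset[OF continuous_on_expansion_param[OF e b1(1)]])
       auto
  then have "continuous (at_right l) h"
    using l by (simp add: continuous_on_Icc_at_rightD continuous_within)
  ultimately have "\<forall>\<^sub>F t in at_right l. h t < 0"
    unfolding continuous_within by (rule order_tendstoD(2)[rotated])
  moreover have "\<forall>\<^sub>F t in at_right l. t \<in> {l<..<b}"
    using l(2) by (rule eventually_at_right_real)
  ultimately have "\<forall>\<^sub>F t in at_right l. h t < 0 \<and> t \<in> {l<..<b}"
    by (rule eventually_conj)
  then obtain t where t: "h t < 0" "l < t" "t < b"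
    using eventually_happens[of _ "at_right l"] by auto
  have above: "x < expansion e t"
    using expansion_strict_mono[OF e, of l t l] t l b1 ex x by simp
  have "t \<notin> Lam m x"
  proof
    assume "t \<in> Lam m x"
    then obtain c where c: "c \<in> digit_seqs m" "expansion c t = x" by (auto simp: Lam_iff)
    then have "t ^ Suc n * (1 - real m * t) / (1 - t) \<le> expansion e t - x"
      using finite_expansion_gap[OF c(1) e e0, of n t] above t l by auto
    then show False using t(1) by (simp add: h_def)
  qed
  then show ?thesis using that t by blast
qed

text \<open>
  Truncating an expansion of \<open>x\<close> at the left end of an interval lowers the value there, and a late
  truncation still exceeds \<open>x\<close> at the right end.  So \<open>x\<close> has a finite expansion at some parameter
  in between, and the gap to the right of that parameter meets the interval.
\<close>

lemma interior_Lam: "interior (Lam m x) = {}"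
proof (rule ccontr)
  assume "interior (Lam m x) \<noteq> {}"
  then obtain l \<epsilon> where \<epsilon>: "\<epsilon> > 0" "ball l \<epsilon> \<subseteq> Lam m x"
    by (metis ex_in_conv mem_interior)
  define b where "b = l + \<epsilon> / 2"
  have sub: "t \<in> Lam m x" if "l \<le> t" "t \<le> b" for t
    using that \<epsilon> by (intro subsetD[OF \<epsilon>(2)]) (auto simp: b_def dist_real_def)
  have lb: "l < b" using \<epsilon> by (simp add: b_def)
  \<comment> \<open>An element of the set beyond \<open>b\<close> makes \<open>b < 1 / m\<close> strict.\<close>
  have "l + 3 * \<epsilon> / 4 \<in> Lam m x"
    using \<epsilon> by (intro subsetD[OF \<epsilon>(2)]) (auto simp: dist_real_def)
  then have b: "b < 1 / real m" using \<epsilon>(1) by (auto simp: Lam_iff b_def)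
  have b1: "b < 1" "l < 1" using b lb inverse_base_less_1 by linarith+
  obtain d where d: "d \<in> digit_seqs m" "expansion d l = x" and l: "0 < l"
    using sub[of l] lb by (auto simp: Lam_iff)
  have bpos: "0 \<le> b" using l lb by simp
  have "x < expansion d b"
    using expansion_strict_mono[OF d(1) _ lb b1(1), of l] d(2) l x by simp
  moreover have "(\<lambda>n. \<Sum>i<n. d i * b ^ Suc i) \<longlonglongrightarrow> expansion d b"
    using expansion_sums[OF d(1) bpos b1(1)] by (simp add: sums_def)
  ultimately have "\<forall>\<^sub>F n in sequentially. x < (\<Sum>i<n. d i * b ^ Suc i)"
    by (rule order_tendstoD(1)[rotated])
  then obtain n where n: "x < (\<Sum>i<n. d i * b ^ Suc i)"
    by (auto simp: eventually_sequentially)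
  define e where "e = (\<lambda>i. if i < n then d i else 0)"
  have e: "e \<in> digit_seqs m" unfolding e_def using d(1) by (rule truncate_in_digit_seqs)
  have "expansion e l \<le> expansion d l"
    using digit_bounds(1)[OF d(1)] l b1
    by (intro sums_le[OF _ expansion_sums[OF e] expansion_sums[OF d(1)]]) (auto simp: e_def)
  then have lo: "expansion e l \<le> x" using d(2) by simp
  have hi: "x < expansion e b" using n by (simp add: e_def expansion_truncate)
  have "continuous_on {l..b} (expansion e)"
    by (rule continuous_on_subset[OF continuous_on_expansion_param[OF e b1(1)]]) (use l in auto)
  then obtain t where t: "l \<le> t" "t \<le> b" "expansion e t = x"
    using IVT'[of "expansion e" l x b] lo hi lb by auto
  then have "t < b" using hi by (cases "t = b") auto
  then obtain t' where "t < t'" "t' < b" "t' \<notin> Lam m x"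
    using Lam_gap_right_of_finite_expansion[OF e, of n t b] t l b by (auto simp: e_def)
  then show False using sub[of t'] t by simp
qed

end

theorem theorem1p1:
  fixes m :: nat and x :: real
  assumes "m \<ge> 2" and "0 < x" and "x < 1"
  shows "cantor_set (Lam m x)
    \<and> (x / (real m - 1 + x) \<in> Lam m x \<and> (\<forall>l\<in>Lam m x. x / (real m - 1 + x) \<le> l))
    \<and> (1 / real m \<in> Lam m x \<and> (\<forall>l\<in>Lam m x. l \<le> 1 / real m))"
proof -
  interpret base_and_target m x using assms by unfold_locales
  have "cantor_set (Lam m x)"
    unfolding cantor_set_def using Lam_max compact_Lam interior_Lam Lam_not_isolated by blast
  then show ?thesis
    using Lam_min Lam_lower_bound Lam_max by (simp add: Lam_iff)
qed

end
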